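(* There is an absolute constant $C>0$ such that the following holds. Let $K,V,T\ge 1$ be integers. For any choices (possibly adversarial, depending on the past allocations of the algorithm) of the volumes $V^t\in\{0,1,\dots,V\}$ and of the maximum consumption levels $s_i^t\ge 0$, $1\le i\le K$, $1\le t\le T$, the regret $R_T$ of the exponentiated gradient dark pool algorithm (described in the context) run for $T$ rounds with learning rate $$\eta=\sqrt{\frac{\ln K}{(e-2)T}}$$ satisfies $$R_T\le C\,V\sqrt{T\ln K},$$ i.e. the regret is $O(V\sqrt{T\ln K})$.
   Context: Dark pool problem with continuous allocations. There are $K$ venues. In each round $t=1,\dots,T$ the learner observes a volume $V^t$ and chooses allocations $v_i^t\ge 0$ ($i=1,\dots,K$) with $\sum_{i=1}^K v_i^t\le V^t$. Venue $i$ has a maximum consumption level $s_i^t$, and the learner receives (and observes only) the consumed amounts $r_i^t=\min(v_i^t,s_i^t)$. The volumes and consumption levels may be chosen by an adversary who knows the learner's previous allocations. Comparators and regret. Let $\Delta_K^V$ be the set of $u=(u^1,\dots,u^V)$ where each $u^v=(u_1^v,\dots,u_K^v)$ is a probability vector in $\mathbb{R}^K$ (nonnegative entries with $\sum_{i=1}^K u_i^v=1$). The comparator $u$ allocates $\sum_{v=1}^{V^t}u_i^v$ to venue $i$ in round $t$. The regret is $$R_T=\max_{u\in\Delta_K^V}\sum_{t=1}^T\sum_{i=1}^K\left[\min\left(\sum_{v=1}^{V^t}u_i^v,\,s_i^t\right)-\min(v_i^t,s_i^t)\right].$$ Exponentiated gradient dark pool algorithm. Input: learning rate $\eta$, bound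 $V$ on the volumes. Initialize $x_{1,i}^v=1/K$ for $v\in\{1,\dots,V\}$, $i\in\{1,\dots,K\}$. For $t=1,\dots,T$: play $v_i^t=\sum_{v=1}^{V^t}x_{t,i}^v$; receive $r_i^t=\min(v_i^t,s_i^t)$; set $g_i^t=1$ if $r_i^t=v_i^t$ and $g_i^t=0$ if $r_i^t<v_i^t$; set $g_{t,i}^v=g_i^t$ if $v\le V^t$ and $g_{t,i}^v=0$ otherwise; update $x_{t+1,i}^v\propto x_{t,i}^v\exp(\eta g_{t,i}^v)$, normalized so that $\sum_{i=1}^K x_{t+1,i}^v=1$ for each $v$. *)

theory Defs
  imports "HOL-Analysis.Analysis"
begin

text \<open>
  Venues are indexed by \<open>1, \<dots>, K\<close>, units of volume by \<open>1, \<dots>, V\<close> and rounds by \<open>1, \<dots>, T\<close>;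
  values of the functions below outside these ranges are irrelevant. Weights and comparators are
  written \<open>x v i\<close>, with the unit \<open>v\<close> first and the venue \<open>i\<close> second.
\<close>

type_synonym allocation = "nat \<Rightarrow> real"
type_synonym weights = "nat \<Rightarrow> nat \<Rightarrow> real"

text \<open>
  An adaptive adversary is a pair of functions mapping the list of all previous allocations of the
  learner (oldest first) to the volume and to the maximum consumption levels of the next round.
\<close>

type_synonym volume_strategy = "allocation list \<Rightarrow> nat"
type_synonym level_strategy = "allocation list \<Rightarrow> nat \<Rightarrow> real"

definition allocate :: "nat \<Rightarrow> weights \<Rightarrow> allocation" where
  "allocate n x i = (\<Sum>v=1..n. x v i)"

definition consumed :: "allocation \<Rightarrow> (nat \<Rightarrow> real) \<Rightarrow> nat \<Rightarrow> real" where
  "consumed a s i = min (a i) (s i)"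

definition gradient :: "nat \<Rightarrow> allocation \<Rightarrow> (nat \<Rightarrow> real) \<Rightarrow> weights" where
  "gradient n a r v i = (if v \<le> n \<and> r i = a i then 1 else 0)"

definition eg_update :: "nat \<Rightarrow> real \<Rightarrow> weights \<Rightarrow> weights \<Rightarrow> weights" where
  "eg_update K \<eta> g x v i =
     x v i * exp (\<eta> * g v i) / (\<Sum>j=1..K. x v j * exp (\<eta> * g v j))"

text \<open>
  \<open>play K \<eta> vol lev t\<close> is the list of allocations in rounds \<open>1, \<dots>, t\<close> together with the weights
  used in round \<open>t + 1\<close>. The update only sees the volume \<open>n\<close>, the allocation \<open>a\<close> and the consumed
  amounts \<open>r\<close>, never the consumption levels. The weights of units beyond the volume bound are also
  initialised, but are never used as long as volumes respect the bound.
\<close>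

primrec play ::
  "nat \<Rightarrow> real \<Rightarrow> volume_strategy \<Rightarrow> level_strategy \<Rightarrow> nat \<Rightarrow> allocation list \<times> weights"
where
  "play K \<eta> vol lev 0 = ([], \<lambda>v i. 1 / real K)"
| "play K \<eta> vol lev (Suc t) =
     (let (h, x) = play K \<eta> vol lev t;
          n = vol h;
          a = allocate n x;
          r = consumed a (lev h)
      in (h @ [a], eg_update K \<eta> (gradient n a r) x))"

definition volume_at ::
  "nat \<Rightarrow> real \<Rightarrow> volume_strategy \<Rightarrow> level_strategy \<Rightarrow> nat \<Rightarrow> nat" where
  "volume_at K \<eta> vol lev t = vol (fst (play K \<eta> vol lev (t - 1)))"

definition level_at ::
  "nat \<Rightarrow> real \<Rightarrow> volume_strategy \<Rightarrow> level_strategy \<Rightarrow> nat \<Rightarrow> nat \<Rightarrow> real" where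
  "level_at K \<eta> vol lev t = lev (fst (play K \<eta> vol lev (t - 1)))"

definition allocation_at ::
  "nat \<Rightarrow> real \<Rightarrow> volume_strategy \<Rightarrow> level_strategy \<Rightarrow> nat \<Rightarrow> allocation" where
  "allocation_at K \<eta> vol lev t =
     allocate (volume_at K \<eta> vol lev t) (snd (play K \<eta> vol lev (t - 1)))"

definition comparators :: "nat \<Rightarrow> nat \<Rightarrow> weights set" where
  "comparators K V =
     {u. \<forall>v\<in>{1..V}. (\<forall>i\<in>{1..K}. 0 \<le> u v i) \<and> (\<Sum>i=1..K. u v i) = 1}"

definition regret_against ::
  "nat \<Rightarrow> nat \<Rightarrow> real \<Rightarrow> volume_strategy \<Rightarrow> level_strategy \<Rightarrow> weights \<Rightarrow> real" where
  "regret_against K T \<eta> vol lev u =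
     (\<Sum>t=1..T. \<Sum>i=1..K.
        consumed (allocate (volume_at K \<eta> vol lev t) u) (level_at K \<eta> vol lev t) i
        - consumed (allocation_at K \<eta> vol lev t) (level_at K \<eta> vol lev t) i)"

text \<open>
  The regret is a supremum of reals; lemma \<open>regret_attained\<close> below shows that it is a maximum.
\<close>

definition regret ::
  "nat \<Rightarrow> nat \<Rightarrow> nat \<Rightarrow> real \<Rightarrow> volume_strategy \<Rightarrow> level_strategy \<Rightarrow> real" where
  "regret K V T \<eta> vol lev = (SUP u\<in>comparators K V. regret_against K T \<eta> vol lev u)"

lemma compact_unit_weights: "compact {u :: weights. \<forall>v i. u v i \<in> {0..1}}"
proof -
  have 1: "compactin euclidean (PiE UNIV (\<lambda>i::nat. {0..1::real}))"
    unfolding euclidean_product_topology[symmetric] by (subst compactin_PiE) auto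
  have 2: "compactin euclidean (PiE UNIV (\<lambda>v::nat. PiE UNIV (\<lambda>i::nat. {0..1::real})))"
    using 1 unfolding euclidean_product_topology[symmetric, where 'b = "nat \<Rightarrow> real"]
    by (subst compactin_PiE) auto
  have "PiE UNIV (\<lambda>v::nat. PiE UNIV (\<lambda>i::nat. {0..1::real})) = {u. \<forall>v i. u v i \<in> {0..1}}"
    by (auto simp: PiE_def Pi_def extensional_def)
  with 2 show ?thesis by simp
qed

lemma continuous_on_weight [continuous_intros]: "continuous_on S (\<lambda>u :: weights. u v i)"
proof -
  have "continuous_on UNIV (\<lambda>u :: weights. u v)"
    by (rule continuous_on_product_coordinates)
  from continuous_on_product_then_coordinatewise[OF this]
  show ?thesis by (rule continuous_on_subset) auto
qed

lemma regret_attained: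
  assumes K: "K \<ge> 1"
    and vol: "\<And>t. t \<in> {1..T} \<Longrightarrow> volume_at K \<eta> vol lev t \<le> V"
  shows "\<exists>u\<in>comparators K V. regret K V T \<eta> vol lev = regret_against K T \<eta> vol lev u \<and>
           (\<forall>w\<in>comparators K V. regret_against K T \<eta> vol lev w \<le> regret_against K T \<eta> vol lev u)"
proof -
  let ?f = "regret_against K T \<eta> vol lev"
  let ?B = "{u :: weights. \<forall>v i. u v i \<in> {0..1}}"
  have closed: "closed (comparators K V)"
  proof -
    have "comparators K V =
        (\<Inter>v\<in>{1..V}. (\<Inter>i\<in>{1..K}. {u. 0 \<le> u v i}) \<inter> {u. (\<Sum>i=1..K. u v i) = 1})"
      by (auto simp: comparators_def)
    moreover have "closed \<dots>"
      by (intro closed_INT closed_Int ballI closed_Collect_le closed_Collect_eq continuous_intros)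
    ultimately show ?thesis by simp
  qed
  have compact: "compact (?B \<inter> comparators K V)"
    by (intro compact_Int_closed compact_unit_weights closed)
  have cont: "continuous_on (?B \<inter> comparators K V) ?f"
    unfolding regret_against_def consumed_def allocate_def
    by (intro continuous_intros)
  have ne: "A \<noteq> {}" if "a \<in> A" for a :: weights and A
    using that by auto
  have "((\<lambda>v i. 1 / real K) :: weights) \<in> ?B \<inter> comparators K V"
    using K by (auto simp: comparators_def)
  then have "?B \<inter> comparators K V \<noteq> {}" by (rule ne)
  from continuous_attains_sup[OF compact this cont] obtain u
    where u: "u \<in> ?B \<inter> comparators K V"
      and max: "\<And>w. w \<in> ?B \<inter> comparators K V \<Longrightarrow> ?f w \<le> ?f u"
    by blast
  have le: "?f w \<le> ?f u" if w: "w \<in> comparators K V" for w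
  proof -
    define w' where "w' = (\<lambda>v i. if v \<in> {1..V} \<and> i \<in> {1..K} then w v i else 0)"
    have "w v i \<le> 1" if "v \<in> {1..V}" "i \<in> {1..K}" for v i
      using w that member_le_sum[of i "{1..K}" "w v"] by (auto simp: comparators_def)
    then have "w' \<in> ?B \<inter> comparators K V"
      using w by (auto simp: comparators_def w'_def)
    moreover have "?f w' = ?f w"
      unfolding regret_against_def
    proof (intro sum.cong refl)
      fix t i assume "t \<in> {1..T}" "i \<in> {1..K}"
      then have "allocate (volume_at K \<eta> vol lev t) w' i = allocate (volume_at K \<eta> vol lev t) w i"
        using vol[of t] by (auto simp: allocate_def w'_def intro!: sum.cong)
      then show "consumed (allocate (volume_at K \<eta> vol lev t) w') (level_at K \<eta> vol lev t) i
          - consumed (allocation_at K \<eta> vol lev t) (level_at K \<eta> vol lev t) i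
        = consumed (allocate (volume_at K \<eta> vol lev t) w) (level_at K \<eta> vol lev t) i
          - consumed (allocation_at K \<eta> vol lev t) (level_at K \<eta> vol lev t) i"
        by (simp add: consumed_def)
    qed
    ultimately show ?thesis using max[of w'] by (simp only:)
  qed
  have "regret K V T \<eta> vol lev = ?f u"
    unfolding regret_def using u le by (intro cSup_eq_maximum) auto
  with u le show ?thesis by blast
qed

end

theory Submission
  imports Defs "HOL-Probability.Hoeffding"
begin

text \<open>
  The map \<open>y \<mapsto> min(y, s)\<close> is concave and \<open>g\<^sub>i\<^sup>t\<close> is a supergradient of it at the played allocation, so
  the regret is at most the sum over the \<open>V\<close> units of the linear regrets of independent
  copies of exponentiated gradient with gains in \<open>[0, 1]\<close>. By Hoeffding's lemma every normalising
  factor is at most \<open>exp(\<eta> p + \<eta>\<^sup>2/8)\<close>, where \<open>p\<close> is the learner's gain; since a final weight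
  never exceeds \<open>1\<close>, each copy has regret at most \<open>ln K / \<eta> + T \<eta> / 8\<close>. Using Hoeffding's lemma in place
  of \<open>exp(z) \<le> 1 + z + (e - 2) z\<^sup>2\<close> avoids having to assume \<open>\<eta> \<le> 1\<close>.
\<close>

section \<open>Exponentiated gradient on one probability simplex\<close>

text \<open>Convexity replaces \<open>exp (\<eta> * g i)\<close> by its chord on [0,1], so the
  mixture is dominated by the moment generating function of a Bernoulli variable with mean
  \<open>p\<close>, which Hoeffding's estimate controls.\<close>

lemma exp_mixture_le:
  fixes w g :: "'a \<Rightarrow> real"
  assumes "\<eta> \<ge> 0" "finite A" and w: "\<And>i. i \<in> A \<Longrightarrow> w i \<ge> 0" "sum w A = 1"
    and g: "\<And>i. i \<in> A \<Longrightarrow> g i \<in> {0..1}"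
  shows "(\<Sum>i\<in>A. w i * exp (\<eta> * g i)) \<le> exp (\<eta> * (\<Sum>i\<in>A. w i * g i) + \<eta>\<^sup>2 / 8)"
proof -
  define p where "p = (\<Sum>i\<in>A. w i * g i)"
  have p: "p \<ge> 0"
    unfolding p_def using w g by (intro sum_nonneg mult_nonneg_nonneg) auto
  have pos: "1 + p * (exp \<eta> - 1) > 0"
    using p \<open>\<eta> \<ge> 0\<close> by (intro add_pos_nonneg mult_nonneg_nonneg) auto
  have chord: "exp (\<eta> * y) \<le> 1 + y * (exp \<eta> - 1)" if "y \<in> {0..1}" for y :: real
    using convex_onD[OF convex_on_exp[OF \<open>\<eta> \<ge> 0\<close>], of y 0 1] that by (auto simp: algebra_simps)
  have "(\<Sum>i\<in>A. w i * exp (\<eta> * g i)) \<le> (\<Sum>i\<in>A. w i * (1 + g i * (exp \<eta> - 1)))"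
    using w g by (intro sum_mono mult_left_mono chord) auto
  also have "\<dots> = 1 + p * (exp \<eta> - 1)"
    using w by (simp add: p_def algebra_simps sum.distrib sum_distrib_left sum_subtractf)
  also have "\<dots> = exp (ln (1 + p * (exp \<eta> - 1)))"
    using pos by simp
  also have "\<dots> \<le> exp (\<eta> * p + \<eta>\<^sup>2 / 8)"
    using Hoeffdings_lemma_aux[OF \<open>\<eta> \<ge> 0\<close> p] by (subst exp_le_cancel_iff) linarith
  finally show ?thesis by (simp add: p_def)
qed

lemma exponentiated_gradient_simplex:
  fixes x g :: "nat \<Rightarrow> nat \<Rightarrow> real"
  assumes K: "K \<ge> 1" and init: "\<And>i. x 0 i = 1 / real K"
    and step: "\<And>t i. x (Suc t) i =
      x t i * exp (\<eta> * g t i) / (\<Sum>j=1..K. x t j * exp (\<eta> * g t j))"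
  shows "(\<forall>i. x t i > 0) \<and> (\<Sum>i=1..K. x t i) = 1"
proof (induction t)
  case 0
  then show ?case using K by (simp add: init)
next
  case (Suc t)
  have "(\<Sum>j=1..K. x t j * exp (\<eta> * g t j)) > 0"
    using K Suc by (intro sum_pos) auto
  then show ?case
    using Suc by (simp add: step sum_divide_distrib[symmetric])
qed

text \<open>Unrolling the updates gives \<open>x n i\<close> as \<open>1 / real K\<close> times the
  product of the gain factors divided by the normalisers, each of which
  \<open>exp_mixture_le\<close> bounds.\<close>

lemma exponentiated_gradient_weight_ge:
  fixes x g :: "nat \<Rightarrow> nat \<Rightarrow> real"
  assumes K: "K \<ge> 1" and eta: "\<eta> \<ge> 0" and init: "\<And>i. x 0 i = 1 / real K"
    and step: "\<And>t i. x (Suc t) i =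
      x t i * exp (\<eta> * g t i) / (\<Sum>j=1..K. x t j * exp (\<eta> * g t j))"
    and g: "\<And>t i. i \<in> {1..K} \<Longrightarrow> g t i \<in> {0..1}"
  shows "exp (\<eta> * (\<Sum>t<n. g t i - (\<Sum>j=1..K. x t j * g t j)) - real n * \<eta>\<^sup>2 / 8) / real K \<le> x n i"
proof (induction n)
  case 0
  then show ?case by (simp add: init)
next
  case (Suc n)
  let ?p = "\<lambda>t. \<Sum>j=1..K. x t j * g t j"
  let ?Z = "\<Sum>j=1..K. x n j * exp (\<eta> * g n j)"
  let ?E = "\<lambda>n. \<eta> * (\<Sum>t<n. g t i - ?p t) - real n * \<eta>\<^sup>2 / 8"
  have simplex: "\<And>i. x n i > 0" "(\<Sum>i=1..K. x n i) = 1"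
    using exponentiated_gradient_simplex[OF K init step, of n] by auto
  have Z_pos: "?Z > 0"
    using K simplex by (intro sum_pos) auto
  have Z_le: "?Z \<le> exp (\<eta> * ?p n + \<eta>\<^sup>2 / 8)"
    using simplex g eta by (intro exp_mixture_le) (auto simp: less_imp_le)
  have "?E (Suc n) = ?E n + \<eta> * g n i - (\<eta> * ?p n + \<eta>\<^sup>2 / 8)"
    by (simp add: algebra_simps add_divide_distrib)
  then have "exp (?E (Suc n)) / real K =
      exp (?E n) / real K * exp (\<eta> * g n i) / exp (\<eta> * ?p n + \<eta>\<^sup>2 / 8)"
    by (simp only: exp_diff exp_add) (simp add: field_simps)
  also have "\<dots> \<le> x n i * exp (\<eta> * g n i) / ?Z"
    using Suc Z_pos Z_le simplex(1)[of i] by (intro frac_le mult_right_mono) auto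
  finally show ?case by (simp add: step)
qed

lemma exponentiated_gradient_regret:
  fixes x g :: "nat \<Rightarrow> nat \<Rightarrow> real" and u :: "nat \<Rightarrow> real"
  assumes K: "K \<ge> 1" and eta: "\<eta> > 0" and init: "\<And>i. x 0 i = 1 / real K"
    and step: "\<And>t i. x (Suc t) i =
      x t i * exp (\<eta> * g t i) / (\<Sum>j=1..K. x t j * exp (\<eta> * g t j))"
    and g: "\<And>t i. i \<in> {1..K} \<Longrightarrow> g t i \<in> {0..1}"
    and u: "\<And>i. i \<in> {1..K} \<Longrightarrow> u i \<ge> 0" "(\<Sum>i=1..K. u i) = 1"
  shows "(\<Sum>t<n. \<Sum>i=1..K. (u i - x t i) * g t i) \<le> ln (real K) / \<eta> + real n * \<eta> / 8"
proof -
  define p where "p t = (\<Sum>j=1..K. x t j * g t j)" for t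
  define B where "B = ln (real K) / \<eta> + real n * \<eta> / 8"
  \<comment> \<open>Comparison with the single venue \<open>i\<close>: an exponential lower bound on
    a weight that cannot exceed 1 caps the cumulative excess gain.\<close>
  have vertex: "(\<Sum>t<n. g t i - p t) \<le> B" if i: "i \<in> {1..K}" for i
  proof -
    have simplex: "\<And>i. x n i > 0" "(\<Sum>i=1..K. x n i) = 1"
      using exponentiated_gradient_simplex[OF K init step, of n] by auto
    have "exp (\<eta> * (\<Sum>t<n. g t i - p t) - real n * \<eta>\<^sup>2 / 8) / real K \<le> x n i"
      unfolding p_def using K eta init step g
      by (intro exponentiated_gradient_weight_ge) (auto simp: less_imp_le)
    also have "x n i \<le> 1"
      using member_le_sum[of i "{1..K}" "x n"] simplex i by (auto simp: less_imp_le)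
    finally have "exp (\<eta> * (\<Sum>t<n. g t i - p t) - real n * \<eta>\<^sup>2 / 8) \<le> exp (ln (real K))"
      using K by (simp add: field_simps)
    then have "\<eta> * (\<Sum>t<n. g t i - p t) \<le> ln (real K) + real n * \<eta>\<^sup>2 / 8"
      by (subst (asm) exp_le_cancel_iff) linarith
    also have "\<dots> = \<eta> * B"
      using eta by (simp add: B_def field_simps power2_eq_square)
    finally show ?thesis using eta by simp
  qed
  \<comment> \<open>As \<open>u\<close> sums to 1, the linear regret against \<open>u\<close> is the
    \<open>u\<close>-average of the regrets against single venues.\<close>
  have "(\<Sum>i=1..K. (u i - x t i) * g t i) = (\<Sum>i=1..K. u i * (g t i - p t))" for t
    using u(2)
    by (simp add: p_def algebra_simps sum_subtractf flip: sum_distrib_left sum_distrib_right)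
  then have "(\<Sum>t<n. \<Sum>i=1..K. (u i - x t i) * g t i) = (\<Sum>t<n. \<Sum>i=1..K. u i * (g t i - p t))"
    by simp
  also have "\<dots> = (\<Sum>i=1..K. u i * (\<Sum>t<n. g t i - p t))"
    by (subst sum.swap) (simp add: sum_distrib_left)
  also have "\<dots> \<le> (\<Sum>i=1..K. u i * B)"
    using u vertex by (intro sum_mono mult_left_mono) auto
  also have "\<dots> = B"
    using u(2) by (simp flip: sum_distrib_right)
  finally show ?thesis by (simp add: B_def)
qed

section \<open>Reduction of the dark pool to linear gains\<close>

lemma consumed_diff_le:
  assumes "n \<le> V"
  shows "consumed (allocate n u) s i - consumed (allocate n x) s i \<le>
    (\<Sum>v=1..V. (u v i - x v i) * gradient n (allocate n x) (consumed (allocate n x) s) v i)"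
proof -
  let ?a = "allocate n x"
  let ?c = "if consumed ?a s i = ?a i then 1 else 0 :: real"
  \<comment> \<open>Units beyond \<open>n\<close> have zero gradient; the others share the value
    \<open>?c\<close> at venue \<open>i\<close>.\<close>
  have "(\<Sum>v=1..V. (u v i - x v i) * gradient n ?a (consumed ?a s) v i) =
      (\<Sum>v=1..n. (u v i - x v i) * ?c)"
    using assms by (intro sum.mono_neutral_cong_right) (auto simp: gradient_def)
  also have "\<dots> = (allocate n u i - ?a i) * ?c"
    by (simp add: allocate_def sum_subtractf flip: sum_distrib_right)
  \<comment> \<open>If \<open>?a i\<close> is fully consumed, the comparator still consumes at most
    what it allocates; otherwise the learner consumes \<open>s i\<close>, which the comparator
    cannot exceed.\<close>
  also have "consumed (allocate n u) s i - consumed ?a s i \<le> \<dots>"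
    by (auto simp: consumed_def min_def)
  finally show ?thesis .
qed

definition gradient_at ::
  "nat \<Rightarrow> real \<Rightarrow> volume_strategy \<Rightarrow> level_strategy \<Rightarrow> nat \<Rightarrow> weights" where
  "gradient_at K \<eta> vol lev t =
     gradient (volume_at K \<eta> vol lev t) (allocation_at K \<eta> vol lev t)
       (consumed (allocation_at K \<eta> vol lev t) (level_at K \<eta> vol lev t))"

text \<open>Round \<open>Suc t\<close> is played with the weights of \<open>play\<close> at
  \<open>t\<close>, so its gradient drives the update to stage \<open>Suc t\<close>.\<close>

lemma snd_play_Suc:
  "snd (play K \<eta> vol lev (Suc t)) =
     eg_update K \<eta> (gradient_at K \<eta> vol lev (Suc t)) (snd (play K \<eta> vol lev t))"
  by (simp add: gradient_at_def allocation_at_def volume_at_def level_at_def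
      case_prod_beta Let_def)

lemma regret_against_le_linear:
  assumes "\<And>t. t \<in> {1..T} \<Longrightarrow> volume_at K \<eta> vol lev t \<le> V"
  shows "regret_against K T \<eta> vol lev u \<le>
    (\<Sum>v=1..V. \<Sum>t<T. \<Sum>i=1..K.
       (u v i - snd (play K \<eta> vol lev t) v i) * gradient_at K \<eta> vol lev (Suc t) v i)"
proof -
  let ?d = "\<lambda>t i v. (u v i - snd (play K \<eta> vol lev t) v i) * gradient_at K \<eta> vol lev (Suc t) v i"
  have "regret_against K T \<eta> vol lev u \<le> (\<Sum>t<T. \<Sum>i=1..K. \<Sum>v=1..V. ?d t i v)"
    unfolding regret_against_def
      sum.atLeast1_atMost_eq[of _ T, folded One_nat_def]
  proof (intro sum_mono)
    fix t i assume "t \<in> {..<T}"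
    then have "volume_at K \<eta> vol lev (Suc t) \<le> V"
      by (intro assms) auto
    then show "consumed (allocate (volume_at K \<eta> vol lev (Suc t)) u) (level_at K \<eta> vol lev (Suc t)) i -
        consumed (allocation_at K \<eta> vol lev (Suc t)) (level_at K \<eta> vol lev (Suc t)) i
        \<le> (\<Sum>v=1..V. ?d t i v)"
      unfolding allocation_at_def gradient_at_def
      using consumed_diff_le by fastforce
  qed
  \<comment> \<open>The sum over units moves outermost, since each unit runs its own copy of
    exponentiated gradient.\<close>
  also have "\<dots> = (\<Sum>t<T. \<Sum>v=1..V. \<Sum>i=1..K. ?d t i v)"
    by (intro sum.cong refl sum.swap)
  also have "\<dots> = (\<Sum>v=1..V. \<Sum>t<T. \<Sum>i=1..K. ?d t i v)"
    by (rule sum.swap)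
  finally show ?thesis .
qed

section \<open>The prescribed learning rate and the final bound\<close>

text \<open>At this rate the two terms \<open>ln (real K) / \<eta>\<close> and
  \<open>real T * \<eta> / 8\<close> become \<open>c\<close> and \<open>1 / (8 * c)\<close> times
  the same square root.\<close>

lemma unit_regret_le:
  fixes \<eta> :: real
  defines "c \<equiv> sqrt (exp 1 - 2) :: real"
  assumes K: "K \<ge> 1" and T: "T \<ge> 1"
    and eta: "\<eta> = sqrt (ln (real K) / ((exp 1 - 2) * real T))"
    and u: "\<And>i. i \<in> {1..K} \<Longrightarrow> w i \<ge> 0" "(\<Sum>i=1..K. w i) = 1"
  shows "(\<Sum>t<T. \<Sum>i=1..K.
      (w i - snd (play K \<eta> vol lev t) v i) * gradient_at K \<eta> vol lev (Suc t) v i)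
    \<le> (c + 1 / (8 * c)) * sqrt (real T * ln (real K))"
proof -
  define x where "x t = snd (play K \<eta> vol lev t) v" for t
  define g where "g t = gradient_at K \<eta> vol lev (Suc t) v" for t
  have init: "x 0 i = 1 / real K" for i
    by (simp add: x_def)
  have step: "x (Suc t) i = x t i * exp (\<eta> * g t i) / (\<Sum>j=1..K. x t j * exp (\<eta> * g t j))" for t i
    by (simp only: x_def g_def snd_play_Suc eg_update_def)
  have "(\<Sum>t<T. \<Sum>i=1..K. (w i - x t i) * g t i) \<le> (c + 1 / (8 * c)) * sqrt (real T * ln (real K))"
  \<comment> \<open>For \<open>K = 1\<close> the rate is 0, while the general regret bound needs a
    positive one. All weight then sits on the only venue, and both sides vanish.\<close>
  proof (cases "K = 1")
    case True
    then have "x t 1 = 1" for t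
      using exponentiated_gradient_simplex[OF K init step, of t] by simp
    then show ?thesis
      using True u(2) by simp
  next
    case False
    then have K2: "K \<ge> 2" using K by simp
    \<comment> \<open>The Taylor bound 1 + 1 + 1/2 places e above 2, which makes \<open>c\<close>
      positive.\<close>
    have "exp 1 \<ge> (5/2 :: real)"
      using exp_lower_Taylor_quadratic[of 1] by simp
    then have c: "c > 0"
      by (simp add: c_def)
    have T0: "sqrt (real T) > 0"
      using T by simp
    have L0: "sqrt (ln (real K)) > 0"
      using K2 by simp
    have eta': "\<eta> = sqrt (ln (real K)) / (c * sqrt (real T))"
      by (simp add: eta c_def real_sqrt_divide real_sqrt_mult)
    have eta_pos: "\<eta> > 0"
      using c T0 L0 by (simp add: eta')
    have "(\<Sum>t<T. \<Sum>i=1..K. (w i - x t i) * g t i) \<le> ln (real K) / \<eta> + real T * \<eta> / 8"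
      using K eta_pos init step u
      by (intro exponentiated_gradient_regret) (auto simp: g_def gradient_at_def gradient_def)
    also have "ln (real K) / \<eta> = c * (sqrt (real T) * sqrt (ln (real K)))"
    proof -
      \<comment> \<open>Splitting into square roots lets one factor cancel against
        \<open>\<eta>\<close>.\<close>
      have "ln (real K) = sqrt (ln (real K)) * sqrt (ln (real K))"
        using K by simp
      also have "\<dots> / \<eta> = c * (sqrt (real T) * sqrt (ln (real K)))"
        unfolding eta' using c T0 L0 by (simp add: field_simps)
      finally show ?thesis .
    qed
    also have "real T * \<eta> / 8 = 1 / (8 * c) * (sqrt (real T) * sqrt (ln (real K)))"
    proof -
      have "real T = sqrt (real T) * sqrt (real T)"
        by simp
      also have "\<dots> * \<eta> / 8 = 1 / (8 * c) * (sqrt (real T) * sqrt (ln (real K)))"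
        unfolding eta' using c T0 by (simp add: field_simps)
      finally show ?thesis .
    qed
    finally show ?thesis
      by (simp add: real_sqrt_mult algebra_simps)
  qed
  then show ?thesis
    by (simp only: x_def g_def)
qed

theorem theorem1:
  "\<exists>C::real. C > 0 \<and>
    (\<forall>(K::nat) (V::nat) (T::nat) (vol::volume_strategy) (lev::level_strategy) (\<eta>::real).
      K \<ge> 1 \<longrightarrow> V \<ge> 1 \<longrightarrow> T \<ge> 1 \<longrightarrow>
      \<eta> = sqrt (ln (real K) / ((exp 1 - 2) * real T)) \<longrightarrow>
      (\<forall>t\<in>{1..T}. volume_at K \<eta> vol lev t \<le> V) \<longrightarrow>
      (\<forall>t\<in>{1..T}. \<forall>i\<in>{1..K}. 0 \<le> level_at K \<eta> vol lev t i) \<longrightarrow>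
      regret K V T \<eta> vol lev \<le> C * real V * sqrt (real T * ln (real K)))"
proof -
  \<comment> \<open>The witness for \<open>C\<close> is \<open>c + 1 / (8 * c)\<close>, the constant
    of \<open>unit_regret_le\<close>.\<close>
  define c :: real where "c = sqrt (exp 1 - 2)"
  have "exp 1 \<ge> (5/2 :: real)"
    using exp_lower_Taylor_quadratic[of 1] by simp
  then have "c > 0"
    by (simp add: c_def)
  then have "c + 1 / (8 * c) > 0"
    by (intro add_pos_pos) auto
  moreover have "regret K V T \<eta> vol lev \<le> (c + 1 / (8 * c)) * real V * sqrt (real T * ln (real K))"
    if K: "K \<ge> 1" and T: "T \<ge> 1"
      and eta: "\<eta> = sqrt (ln (real K) / ((exp 1 - 2) * real T))"
      and vol: "\<forall>t\<in>{1..T}. volume_at K \<eta> vol lev t \<le> V"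
    for K V T :: nat and vol lev \<eta>
  proof -
    let ?b = "(c + 1 / (8 * c)) * sqrt (real T * ln (real K))"
    \<comment> \<open>The supremum is attained, so it suffices to bound one maximising
      comparator.\<close>
    obtain u where u: "u \<in> comparators K V"
      and reg: "regret K V T \<eta> vol lev = regret_against K T \<eta> vol lev u"
      using regret_attained[OF K, of T \<eta> vol lev V] vol by blast
    have "regret_against K T \<eta> vol lev u \<le> (\<Sum>v=1..V. \<Sum>t<T. \<Sum>i=1..K.
       (u v i - snd (play K \<eta> vol lev t) v i) * gradient_at K \<eta> vol lev (Suc t) v i)"
      using vol by (intro regret_against_le_linear) auto
    \<comment> \<open>Every unit obeys the same bound \<open>?b\<close>, whence the factor
      \<open>V\<close>.\<close>
    also have "\<dots> \<le> (\<Sum>v=1..V. ?b)"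
      unfolding c_def using u
      by (intro sum_mono unit_regret_le[OF K T eta]) (auto simp: comparators_def)
    finally show ?thesis
      by (simp add: reg mult_ac)
  qed
  ultimately show ?thesis by blast
qed

end
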